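(* Let $U\subset\mathbb{C}$ be an open subset, let $n\in\mathbb{N}$, and let $X\subset U$ be a Polish space (with the subspace topology) having characteristic system $(1,n)$. Let $f:U\to\mathbb{C}$ be a function that is continuous in $U$ and analytic in $U\setminus X$. Then \[ \int_{[z_1,z_2,z_3,z_1]} f(z)\,dz = 0 \] for every triangle $\triangle(z_1,z_2,z_3)\subset U$.
   Context: A Polish space is a separable completely metrizable topological space. For a Polish space $X$, its Cantor-Bendixson derivative is $X'=\{x\in X : x \text{ is a limit point of } X\}$; set $X^{0}=X$ and $X^{k}=(X^{k-1})'$ for $k\geq 1$. A countable Polish space $X$ has characteristic system $(k,n)$, with $n$ a natural number, if $X^{k}\neq\emptyset$, $X^{k+1}=\emptyset$ and the cardinality of $X^{k}$ is $n$. (Having a characteristic system includes being countable.) Here $\triangle(z_1,z_2,z_3)$ denotes the closed (filled) triangle with non-collinear vertices $z_1,z_2,z_3\in\mathbb{C}$, and $[z_1,z_2,z_3,z_1]$ is the closed polygonal curve running along straight segments from $z_1$ to $z_2$ to $z_3$ to $z_1$, parametrizing the boundary of the triangle. *)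

theory Defs
  imports "HOL-Complex_Analysis.Complex_Analysis"
begin

definition Polish_space :: "'a topology \<Rightarrow> bool" where
  "Polish_space T \<longleftrightarrow> separable_space T \<and> completely_metrizable_space T"

text \<open>The Cantor-Bendixson derivative is again a space, carrying the subspace topology, so that
  in the iteration limit points are taken within the previous derivative.\<close>

definition cb_derivative :: "'a topology \<Rightarrow> 'a topology" where
  "cb_derivative T = subtopology T (T derived_set_of (topspace T))"

definition cb_derivative_iter :: "nat \<Rightarrow> 'a topology \<Rightarrow> 'a topology" where
  "cb_derivative_iter k T = (cb_derivative ^^ k) T"

text \<open>The finiteness clause is needed because \<open>card\<close> is 0 on infinite sets.\<close>

definition has_characteristic_system :: "'a topology \<Rightarrow> nat \<Rightarrow> nat \<Rightarrow> bool" where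
  "has_characteristic_system T k n \<longleftrightarrow>
     Polish_space T \<and> countable (topspace T) \<and>
     topspace (cb_derivative_iter k T) \<noteq> {} \<and>
     topspace (cb_derivative_iter (Suc k) T) = {} \<and>
     finite (topspace (cb_derivative_iter k T)) \<and>
     card (topspace (cb_derivative_iter k T)) = n"

end

theory Submission
  imports Defs
begin

text \<open>The set of points of \<open>U\<close> at which \<open>f\<close> fails to be analytic is contained in \<open>X\<close> and has no
  isolated point, because isolated singularities of continuous functions are removable. So it
  misses the isolated points of \<open>X\<close> and lies in the finite first derivative of \<open>X\<close>; being finite
  without isolated points, it is empty, and Cauchy's theorem for triangles applies.\<close>

text \<open>For a point of \<open>X\<close>, accumulation in the subspace is the same as in the
  ambient space, so \<open>islimpt\<close> can replace the abstract derivative.\<close>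

lemma topspace_cb_derivative_top_of_set:
  "topspace (cb_derivative_iter 1 (top_of_set X)) = {x \<in> X. x islimpt X}"
proof -
  have "euclidean derived_set_of X = {x. x islimpt X}"
    unfolding derived_set_of_def islimpt_def by (simp, blast)
  then show ?thesis
    by (simp add: cb_derivative_iter_def cb_derivative_def derived_set_of_subtopology Int_def)
qed

lemma analytic_at_isolated_singularity:
  fixes f :: "complex \<Rightarrow> complex"
  assumes "open U" "p \<in> U" "continuous_on U f"
    and isolated: "\<not> p islimpt {z \<in> U. \<not> f analytic_on {z}}"
  shows "f analytic_on {p}"
proof -
  obtain T where T: "p \<in> T" "open T" "\<And>z. z \<in> U \<inter> T \<Longrightarrow> z \<noteq> p \<Longrightarrow> f analytic_on {z}"
    using isolated unfolding islimpt_def by blast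
  have "f analytic_on U \<inter> T - {p}"
    using T(3) unfolding analytic_on_def by blast
  then have "f holomorphic_on U \<inter> T - {p}"
    by (rule analytic_imp_holomorphic)
  moreover have "continuous_on (U \<inter> T) f"
    using assms(3) by (rule continuous_on_subset) blast
  ultimately have "f holomorphic_on U \<inter> T"
    using no_isolated_singularity[of "U \<inter> T" f "{p}"] assms(1) T(2) by blast
  moreover have "open (U \<inter> T)" "p \<in> U \<inter> T"
    using assms(1,2) T(1,2) by auto
  ultimately show ?thesis
    unfolding analytic_at by blast
qed

lemma analytic_off_finite_derived_set:
  fixes f :: "complex \<Rightarrow> complex"
  assumes "open U" "continuous_on U f" "f analytic_on (U - X)"
    and finite: "finite {x \<in> X. x islimpt X}"
  shows "f analytic_on U"
proof -
  define S where "S = {z \<in> U. \<not> f analytic_on {z}}"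
  have "S \<subseteq> X"
    using assms(3) unfolding S_def analytic_on_def by blast
  have limpt: "p islimpt S" if "p \<in> S" for p
    using analytic_at_isolated_singularity[OF assms(1) _ assms(2)] that by (auto simp: S_def)
  \<comment> \<open>A limit point of \<open>S\<close> is also one of the larger set
    \<open>X\<close>.\<close>
  then have "S \<subseteq> {x \<in> X. x islimpt X}"
    using \<open>S \<subseteq> X\<close> islimpt_subset by blast
  then have "finite S"
    using finite finite_subset by blast
  then have "S = {}"
    using limpt islimpt_finite by blast
  then show ?thesis
    unfolding S_def analytic_on_def by blast
qed

theorem theorem1p3:
  fixes U X :: "complex set" and n :: nat and f :: "complex \<Rightarrow> complex"
    and z\<^sub>1 z\<^sub>2 z\<^sub>3 :: complex
  assumes "open U"
    and "X \<subseteq> U"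
    and "Polish_space (top_of_set X)"
    and "has_characteristic_system (top_of_set X) 1 n"
    and "continuous_on U f"
    and "f analytic_on (U - X)"
    and "\<not> collinear {z\<^sub>1, z\<^sub>2, z\<^sub>3}"
    and "convex hull {z\<^sub>1, z\<^sub>2, z\<^sub>3} \<subseteq> U"
  shows "(f has_contour_integral 0)
           (linepath z\<^sub>1 z\<^sub>2 +++ linepath z\<^sub>2 z\<^sub>3 +++ linepath z\<^sub>3 z\<^sub>1)"
proof -
  \<comment> \<open>This is the finiteness clause at level 1; the index must stay \<open>1\<close>,
    not \<open>Suc 0\<close>, to match the rewriting lemma.\<close>
  have "finite {x \<in> X. x islimpt X}"
    using assms(4) by (simp add: has_characteristic_system_def topspace_cb_derivative_top_of_set
        del: One_nat_def)
  then have "f analytic_on U"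
    using analytic_off_finite_derived_set assms by blast
  \<comment> \<open>\<open>U\<close> may have holes, so Cauchy's theorem is applied on the filled
    triangle inside it.\<close>
  then have "f holomorphic_on convex hull {z\<^sub>1, z\<^sub>2, z\<^sub>3}"
    using assms(8) analytic_imp_holomorphic holomorphic_on_subset by blast
  then show ?thesis
    by (rule Cauchy_theorem_triangle)
qed

end
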